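(* Let $M\ge1$ be an integer and let $$D_M:=\left\{\sum_{i=1}^n\frac{d_i}{(M+1)^i}: d_i\in\{0,1,\ldots,M\}\ \text{for all } 1\le i\le n;\ n\in\mathbb N\right\}.$$ For any finitely many $x_1,\ldots,x_\ell\in D_M$ we have $$\dim_H\bigcap_{i=1}^\ell\mathcal U(x_i)=1,$$ where $\mathcal U(x)$ denotes the set of $q\in(1,M+1]$ such that $x$ has a unique expansion in base $q$ over the alphabet $\{0,1,\ldots,M\}$.
   Context: Fix an integer $M\ge1$. For $q\in(1,M+1]$, an expansion of $x\ge0$ in base $q$ is a sequence $(d_i)\in\{0,1,\ldots,M\}^{\mathbb N}$ with $x=\sum_{i=1}^\infty d_iq^{-i}$. $\mathcal U(x)$ is the set of all $q\in(1,M+1]$ for which $x$ has exactly one expansion in base $q$. $\dim_H$ denotes Hausdorff dimension of subsets of $\mathbb R$. *)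

theory Defs
  imports "HOL-Analysis.Analysis"
begin

text \<open>
  Hausdorff measure and dimension are not in the library; the following is the standard
  construction through countable covers by sets of small diameter.

  The weight of a covering set is its diameter to the power \<open>s\<close>, where the empty set has weight 0
  and a nonempty set has weight 1 for \<open>s = 0\<close>; the case split is needed since \<open>0 powr 0 = 0\<close> in HOL.
\<close>

definition diam_weight :: "real \<Rightarrow> 'a::metric_space set \<Rightarrow> ennreal" where
  "diam_weight s U =
     (if U = {} then 0 else if s = 0 then 1 else ennreal (diameter U powr s))"

text \<open>
  Boundedness of the covering sets is required explicitly because the real-valued
  \<^const>\<open>diameter\<close> is unspecified on unbounded sets.
\<close>

definition small_covers :: "real \<Rightarrow> 'a::metric_space set \<Rightarrow> (nat \<Rightarrow> 'a set) set" where
  "small_covers \<delta> E =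
     {U. E \<subseteq> (\<Union>i. U i) \<and> (\<forall>i. bounded (U i) \<and> diameter (U i) \<le> \<delta>)}"

definition hausdorff_premeasure :: "real \<Rightarrow> real \<Rightarrow> 'a::metric_space set \<Rightarrow> ennreal" where
  "hausdorff_premeasure s \<delta> E = (INF U\<in>small_covers \<delta> E. \<Sum>i. diam_weight s (U i))"

definition hausdorff_measure :: "real \<Rightarrow> 'a::metric_space set \<Rightarrow> ennreal" where
  "hausdorff_measure s E = (SUP \<delta>\<in>{0<..}. hausdorff_premeasure s \<delta> E)"

definition hausdorff_dim :: "'a::metric_space set \<Rightarrow> ennreal" where
  "hausdorff_dim E = Inf {ennreal s |s. 0 \<le> s \<and> hausdorff_measure s E = 0}"

text \<open>
  Digit sequences are indexed from 0, so \<open>d i\<close> is the coefficient of \<open>q\<close> to the power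
  \<open>-(i + 1)\<close>. Indexing from 1 would leave \<open>d 0\<close> free and destroy uniqueness.
\<close>

definition is_expansion :: "nat \<Rightarrow> real \<Rightarrow> real \<Rightarrow> (nat \<Rightarrow> nat) \<Rightarrow> bool" where
  "is_expansion M q x d \<longleftrightarrow>
     (\<forall>i. d i \<in> {0..M}) \<and> (\<lambda>i. real (d i) / q ^ Suc i) sums x"

definition univoque_bases :: "nat \<Rightarrow> real \<Rightarrow> real set" where
  "univoque_bases M x = {q \<in> {1<..real M + 1}. \<exists>!d. is_expansion M q x d}"

definition finite_expansions :: "nat \<Rightarrow> real set" where
  "finite_expansions M =
     {\<Sum>i = 1..n. real (d i) / (real M + 1) ^ i |(d :: nat \<Rightarrow> nat) n. \<forall>i\<in>{1..n}. d i \<in> {0..M}}"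

end

theory Submission
  imports Defs "HOL-Real_Asymp.Real_Asymp"
begin

text \<open>
  The upper bound holds for every bounded set of reals. For the lower bound, a base \<open>q\<close> in which \<open>x\<close> has two
  expansions admits an ambiguous prefix: a digit word \<open>d 0, \<dots>, d m\<close> with \<open>d m \<ge> 1\<close>
  after which the rescaled remainder lies in the overlap \<open>[0, M/(q-1) - 1]\<close>, so that the last
  digit could just as well be lowered by one. Hence it suffices to find many bases without ambiguous prefixes.

  Near \<open>q = M + 1\<close> the overlap has a small length \<open>\<rho> \<approx> (M+1-q)/M\<close>. The value of a fixed word is a
  decreasing function of the base with slopes bounded from above and below. Therefore the bases at
  which one word of length \<open>m + 1\<close> is ambiguous for \<open>x\<close> lie within distance \<open>O(\<rho> q\<^bsup>-m\<^esup>)\<close> of each other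
  (\<open>ambiguous_points_of_same_word_close\<close>), whereas bases belonging to distinct words are at distance at least of order
  \<open>q\<^bsup>-m\<^esup>\<close>, provided that no ambiguity occurs below level \<open>m\<close>
  (\<open>ambiguous_points_of_distinct_words_separated\<close>). So an interval \<open>J\<close> whose length is a small multiple of \<open>q\<^bsup>-m\<^esup>\<close>
  contains, for each \<open>x\<close>, only one tiny cluster of bad bases of level \<open>m\<close>.

  Cut \<open>J\<close> into \<open>R\<close> children. Only about \<open>log R\<close> levels \<open>m\<close> belong to this step (\<open>card_window_le\<close>), and each of
  them spoils at most two children for each of the finitely many \<open>x\<close>. Iterating gives a Cantor set in which every
  interval keeps \<open>R - O(log R)\<close> of its \<open>R\<close> children. As \<open>R powr t = o(R)\<close> for \<open>t < 1\<close>, there is enough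
  room to avoid in addition any countable cover of small \<open>t\<close>-weight
  (\<open>cantor_point_avoiding_cover\<close>), so the \<open>t\<close>-dimensional measure is positive.

  The construction needs that no ambiguity occurs at levels too coarse for the initial interval, that is, with \<open>q\<^bsup>-m\<^esup>\<close>
  much larger than its length. This is where the hypothesis on the numbers \<open>x\<close> is used: the value of a word in base \<open>M + 1\<close>
  and \<open>x\<close> itself are both multiples of a power of \<open>1/(M+1)\<close>, so if they differ, they cannot be too close, unless the
  word is long (\<open>ambiguity_level_large\<close>).
\<close>

section \<open>Bounded sets of reals have dimension at most one\<close>

text \<open>
  Cutting \<open>[-h, h]\<close> into \<open>N\<close> equal pieces gives a cover of total weight \<open>N (2h/N) powr s\<close>,
  which tends to 0 since \<open>s > 1\<close>.
\<close>

lemma hausdorff_measure_real_eq_0: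
  fixes E :: "real set"
  assumes "bounded E" "1 < s"
  shows "hausdorff_measure s E = 0"
proof -
  obtain h where h: "0 < h" "\<And>x. x \<in> E \<Longrightarrow> \<bar>x\<bar> \<le> h"
    using assms(1) unfolding bounded_pos by auto
  have pre: "hausdorff_premeasure s \<delta> E = 0" if "0 < \<delta>" for \<delta>
  proof -
    define U where "U N i = (if i < N then {- h + 2 * h * real i / real N .. - h + 2 * h * real (Suc i) / real N} else {})" for N i :: nat
    have diam: "diameter (U N i) = 2 * h / real N" if "i < N" for N i
    proof -
      have "- h + 2 * h * real i / real N \<le> - h + 2 * h * real (Suc i) / real N"
        using h that by (simp add: divide_right_mono mult_left_mono)
      then have "diameter (U N i) = (- h + 2 * h * real (Suc i) / real N) - (- h + 2 * h * real i / real N)"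
        using that by (simp add: U_def diameter_closed_interval)
      then show ?thesis using that by (simp add: field_simps)
    qed
    have cov: "E \<subseteq> (\<Union>i. U N i)" if N: "0 < N" for N
    proof
      fix x assume "x \<in> E"
      then have x: "-h \<le> x" "x \<le> h" using h(2) by fastforce+
      show "x \<in> (\<Union>i. U N i)"
      proof (cases "x = h")
        case True
        then have "x \<in> U N (N - 1)" using N h(1) by (simp add: U_def field_simps)
        then show ?thesis by blast
      next
        case False
        define y where "y = (x + h) * real N / (2 * h)"
        have "(x + h) * real N < 2 * h * real N" using x False N by (intro mult_strict_right_mono) auto
        then have y: "0 \<le> y" "y < real N" using x h(1) by (simp_all add: y_def divide_less_eq mult.commute)
        define i where "i = nat \<lfloor>y\<rfloor>"
        have i: "real i \<le> y" "y < real i + 1" using y(1) by (auto simp: i_def)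
        then have iN: "i < N" using y(2) by linarith
        have "x = - h + 2 * h * y / real N" using N h(1) by (simp add: y_def)
        moreover have "2 * h * real i / real N \<le> 2 * h * y / real N" "2 * h * y / real N \<le> 2 * h * real (Suc i) / real N"
          using i h(1) by (auto intro!: divide_right_mono mult_left_mono)
        ultimately have "x \<in> U N i" using iN by (simp add: U_def)
        then show ?thesis by blast
      qed
    qed
    have bound: "hausdorff_premeasure s \<delta> E \<le> ennreal (real N * (2 * h / real N) powr s)"
      if N: "0 < N" "2 * h / real N \<le> \<delta>" for N
    proof -
      have "U N \<in> small_covers \<delta> E"
      proof -
        have "bounded (U N i) \<and> diameter (U N i) \<le> \<delta>" for i
        proof (cases "i < N")
          case True then show ?thesis using diam[OF True] N by (simp add: U_def)
        next
          case False then show ?thesis using \<open>0 < \<delta>\<close> by (simp add: U_def)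
        qed
        then show ?thesis using cov[OF N(1)] by (simp add: small_covers_def)
      qed
      then have "hausdorff_premeasure s \<delta> E \<le> (\<Sum>i. diam_weight s (U N i))"
        unfolding hausdorff_premeasure_def by (rule INF_lower)
      also have "\<dots> = (\<Sum>i<N. diam_weight s (U N i))"
        by (rule suminf_finite) (auto simp: diam_weight_def U_def)
      also have "\<dots> \<le> (\<Sum>i<N. ennreal ((2 * h / real N) powr s))"
        using assms(2) diam by (intro sum_mono) (simp add: diam_weight_def)
      also have "\<dots> = ennreal (real N * (2 * h / real N) powr s)"
        by (simp add: ennreal_mult' ennreal_of_nat_eq_real_of_nat)
      finally show ?thesis .
    qed
    have "(\<lambda>N. real N * (2 * h / real N) powr s) \<longlonglongrightarrow> 0"
      using assms(2) h(1) by real_asymp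
    then have lim: "(\<lambda>N. ennreal (real N * (2 * h / real N) powr s)) \<longlonglongrightarrow> ennreal 0"
      by (rule tendsto_ennrealI)
    have "(\<lambda>N. 2 * h / real N) \<longlonglongrightarrow> 0" by real_asymp
    then have "eventually (\<lambda>N. 2 * h / real N < \<delta>) sequentially"
      using \<open>0 < \<delta>\<close> by (rule order_tendstoD)
    then have "eventually (\<lambda>N. hausdorff_premeasure s \<delta> E \<le> ennreal (real N * (2 * h / real N) powr s)) sequentially"
      using eventually_gt_at_top[of 0] by eventually_elim (rule bound, auto)
    from tendsto_lowerbound[OF lim this] show ?thesis by simp
  qed
  then show ?thesis unfolding hausdorff_measure_def by (simp add: SUP_eq_const[OF _ pre])
qed

lemma hausdorff_dim_real_le_1:
  fixes E :: "real set"
  assumes "bounded E"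
  shows "hausdorff_dim E \<le> 1"
proof (rule ennreal_le_epsilon)
  fix e :: real assume e: "0 < e"
  have "hausdorff_dim E \<le> ennreal (1 + e)"
    unfolding hausdorff_dim_def
    using hausdorff_measure_real_eq_0[OF assms, of "1 + e"] e
    by (intro Inf_lower CollectI exI[of _ "1 + e"]) auto
  also have "\<dots> = 1 + ennreal e" using e by (simp add: ennreal_plus)
  finally show "hausdorff_dim E \<le> 1 + ennreal e" .
qed

section \<open>A Cantor construction that dodges a cover\<close>

text \<open>
  Throughout the construction an interval is cut into \<open>R\<close> closed children of length \<open>c\<close>. A set with
  all distances below \<open>c\<close> cannot reach over a whole child, so it touches two neighbours at most.
\<close>

lemma thin_set_meets_two_children:
  fixes S :: "real set" and a c :: real
  assumes "0 < c" "\<And>u v. u \<in> S \<Longrightarrow> v \<in> S \<Longrightarrow> \<bar>u - v\<bar> < c"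
  shows "card {k. k < R \<and> S \<inter> {a + real k * c .. a + real k * c + c} \<noteq> {}} \<le> 2"
proof (cases "{k. k < R \<and> S \<inter> {a + real k * c .. a + real k * c + c} \<noteq> {}} = {}")
  case False
  define A where "A = {k. k < R \<and> S \<inter> {a + real k * c .. a + real k * c + c} \<noteq> {}}"
  define k0 where "k0 = Min A"
  have fin: "finite A" by (simp add: A_def)
  have k0: "k0 \<in> A" using False fin unfolding k0_def A_def by (intro Min_in)
  have "A \<subseteq> {k0, Suc k0}"
  proof
    fix k assume k: "k \<in> A"
    then have "k0 \<le> k" using fin by (simp add: k0_def)
    obtain u where u: "u \<in> S" "u \<le> a + real k0 * c + c" using k0 by (auto simp: A_def)
    obtain v where v: "v \<in> S" "a + real k * c \<le> v" using k by (auto simp: A_def)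
    have "v - u < c" using assms(2)[OF v(1) u(1)] by linarith
    then have "(real k - real k0) * c < 2 * c" using u v by (simp add: algebra_simps)
    then have "real k - real k0 < 2" using assms(1) by simp
    then have "k < k0 + 2" by linarith
    then show "k \<in> {k0, Suc k0}" using \<open>k0 \<le> k\<close> by auto
  qed
  then have "card A \<le> card {k0, Suc k0}" by (intro card_mono) auto
  then show ?thesis by (simp add: A_def)
next
  case True
  then show ?thesis by (metis card.empty zero_le)
qed

text \<open>
  The total weight of those members of a cover that still reach into \<open>J\<close>. It is the potential that the
  construction keeps small: a cover member that survives in arbitrarily short intervals would keep it
  above a positive constant.
\<close>

definition load :: "(nat \<Rightarrow> real) \<Rightarrow> (nat \<Rightarrow> real set) \<Rightarrow> real set \<Rightarrow> real" where
  "load w U J = (\<Sum>i. if U i \<inter> J \<noteq> {} then w i else 0)"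

lemma load_summable:
  assumes "summable w" "\<And>i. 0 < w i"
  shows "summable (\<lambda>i. if U i \<inter> J \<noteq> {} then w i else (0::real))"
  using assms(1)
  by (rule summable_comparison_test'[where N = 0]) (use assms(2) in \<open>auto intro: less_imp_le simp: abs_of_pos\<close>)

lemma weight_le_load:
  assumes "summable w" "\<And>i. 0 < w i" "U i \<inter> J \<noteq> {}"
  shows "w i \<le> load w U J"
proof -
  have "(\<Sum>j\<in>{i}. if U j \<inter> J \<noteq> {} then w j else 0) \<le> load w U J"
    unfolding load_def
    by (rule sum_le_suminf[OF load_summable[OF assms(1,2)]]) (use assms(2) in \<open>auto intro: less_imp_le\<close>)
  then show ?thesis using assms(3) by simp
qed

text \<open>
  Every member of the cover that meets \<open>J\<close> is thin, so it is charged to at most two children and the loads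
  of all children add up to at most twice the load of \<open>J\<close>. At least \<open>G\<close> children miss the thin sets
  in \<open>F\<close>, and one of them carries at most the average load.
\<close>

lemma exists_light_child:
  fixes w :: "nat \<Rightarrow> real" and a c :: real
  assumes w: "summable w" "\<And>i. 0 < w i"
    and c: "0 < c"
    and J: "J = {a..a + real R * c}"
    and thin: "\<And>i u v. U i \<inter> J \<noteq> {} \<Longrightarrow> u \<in> U i \<Longrightarrow> v \<in> U i \<Longrightarrow> \<bar>u - v\<bar> < c"
    and F: "finite F" "\<And>S u v. S \<in> F \<Longrightarrow> u \<in> S \<Longrightarrow> v \<in> S \<Longrightarrow> \<bar>u - v\<bar> < c"
    and G: "0 < G" "G + 2 * real (card F) \<le> real R"
  shows "\<exists>k<R. (\<Union>F) \<inter> {a + real k * c .. a + real k * c + c} = {}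
               \<and> G * load w U {a + real k * c .. a + real k * c + c} \<le> 2 * load w U J"
proof -
  define I where "I k = {a + real k * c .. a + real k * c + c}" for k
  have IJ: "I k \<subseteq> J" if "k < R" for k
  proof -
    have "real (Suc k) * c \<le> real R * c" using that c by (intro mult_right_mono) auto
    moreover have "0 \<le> real k * c" using c by simp
    ultimately show ?thesis by (auto simp: I_def J algebra_simps)
  qed
  define A where "A = {k. k < R \<and> (\<Union>F) \<inter> I k = {}}"
  have finA: "finite A" by (simp add: A_def)
  have "{..<R} - A \<subseteq> (\<Union>S\<in>F. {k. k < R \<and> S \<inter> I k \<noteq> {}})" by (auto simp: A_def)
  then have "card ({..<R} - A) \<le> card (\<Union>S\<in>F. {k. k < R \<and> S \<inter> I k \<noteq> {}})"
    using F(1) by (intro card_mono) auto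
  also have "\<dots> \<le> (\<Sum>S\<in>F. card {k. k < R \<and> S \<inter> I k \<noteq> {}})" by (rule card_UN_le[OF F(1)])
  also have "\<dots> \<le> (\<Sum>S\<in>F. 2)"
    unfolding I_def by (intro sum_mono thin_set_meets_two_children c F(2))
  finally have "card ({..<R} - A) \<le> 2 * card F" by simp
  moreover have "card ({..<R} - A) = R - card A"
    by (subst card_Diff_subset) (auto simp: A_def)
  moreover have "card A \<le> card {..<R}" by (intro card_mono) (auto simp: A_def)
  ultimately have cardA: "real R - 2 * real (card F) \<le> real (card A)" by (simp add: algebra_simps; linarith)
  have "(\<Sum>k\<in>A. load w U (I k)) = (\<Sum>i. \<Sum>k\<in>A. if U i \<inter> I k \<noteq> {} then w i else 0)"
    unfolding load_def by (rule suminf_sum[symmetric]) (rule load_summable[OF w])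
  also have "\<dots> \<le> (\<Sum>i. 2 * (if U i \<inter> J \<noteq> {} then w i else 0))"
  proof (rule suminf_le)
    fix i
    show "(\<Sum>k\<in>A. if U i \<inter> I k \<noteq> {} then w i else 0) \<le> 2 * (if U i \<inter> J \<noteq> {} then w i else 0)"
    proof (cases "U i \<inter> J = {}")
      case True
      then have "U i \<inter> I k = {}" if "k \<in> A" for k using IJ that by (fastforce simp: A_def)
      then show ?thesis using True by simp
    next
      case False
      have "(\<Sum>k\<in>A. if U i \<inter> I k \<noteq> {} then w i else 0) = real (card {k\<in>A. U i \<inter> I k \<noteq> {}}) * w i"
        using finA by (simp add: sum.If_cases Int_def)
      also have "\<dots> \<le> 2 * w i"
      proof (rule mult_right_mono)
        have "card {k\<in>A. U i \<inter> I k \<noteq> {}} \<le> card {k. k < R \<and> U i \<inter> I k \<noteq> {}}"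
          by (intro card_mono) (auto simp: A_def)
        also have "\<dots> \<le> 2" unfolding I_def by (intro thin_set_meets_two_children c thin[OF False])
        finally show "real (card {k\<in>A. U i \<inter> I k \<noteq> {}}) \<le> 2" by simp
      qed (use w(2) in \<open>auto intro: less_imp_le\<close>)
      finally show ?thesis using False by simp
    qed
  qed (intro summable_sum summable_mult load_summable[OF w])+
  also have "\<dots> = 2 * load w U J" unfolding load_def by (rule suminf_mult[OF load_summable[OF w]])
  finally have tot: "(\<Sum>k\<in>A. load w U (I k)) \<le> 2 * load w U J" .
  have Jnn: "0 \<le> load w U X" for X
    unfolding load_def by (intro suminf_nonneg load_summable[OF w]) (use w(2) in \<open>auto intro: less_imp_le\<close>)
  have GA: "G \<le> real (card A)" using cardA G by linarith
  have "\<exists>k\<in>A. G * load w U (I k) \<le> 2 * load w U J"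
  proof (rule ccontr)
    assume "\<not> ?thesis"
    then have "\<And>k. k \<in> A \<Longrightarrow> 2 * load w U J / G < load w U (I k)"
      using G(1) by (auto simp: field_simps not_le)
    moreover have "A \<noteq> {}" using GA G(1) by auto
    ultimately have "(\<Sum>k\<in>A. 2 * load w U J / G) < (\<Sum>k\<in>A. load w U (I k))"
      using finA by (intro sum_strict_mono)
    moreover have "2 * load w U J \<le> (\<Sum>k\<in>A. 2 * load w U J / G)"
      using mult_right_mono[OF GA Jnn[of J]] G(1) by (simp add: field_simps)
    ultimately show False using tot by linarith
  qed
  then show ?thesis by (auto simp: A_def I_def)
qed

lemma nested_intervals_point:
  fixes a r :: "nat \<Rightarrow> real"
  assumes "\<And>n. 0 \<le> r n" "\<And>n. {a (Suc n)..a (Suc n) + r (Suc n)} \<subseteq> {a n..a n + r n}"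
  shows "\<exists>q. \<forall>n. q \<in> {a n..a n + r n}"
proof -
  have "(\<Inter>n. {a n..a n + r n}) \<noteq> {}"
  proof (rule compact_nest)
    show "{a n..a n + r n} \<subseteq> {a m..a m + r m}" if "m \<le> n" for m n
      using lift_Suc_antimono_le[of "\<lambda>n. {a n..a n + r n}", OF assms(2) that] .
  qed (simp_all add: assms(1))
  then show ?thesis by blast
qed

text \<open>
  The invariant is \<open>load J < (L / R ^ (n + 1)) powr t\<close> for the interval \<open>J\<close> of level \<open>n\<close>. It forces
  every cover member that meets \<open>J\<close> to be thinner than a child, so the averaging argument applies
  with \<open>G = 2 R powr t\<close>; then \<open>2 / G = R powr (- t)\<close> is exactly the factor by which the bound shrinks from one level to
  the next. This is the substitute for a mass distribution on the Cantor set: the bad sets \<open>B\<close> cost at most \<open>2 N\<close>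
  children each time, and as long as \<open>R\<close> leaves room for both losses, no cover of
  small \<open>t\<close>-weight captures all points outside the bad sets. The weights have to be strictly positive: a
  cover member consisting of a single point would not be noticed otherwise.
\<close>

lemma cantor_point_avoiding_cover:
  fixes a0 L t :: real and R N :: nat and B U :: "nat \<Rightarrow> real set" and w :: "nat \<Rightarrow> real"
  assumes L: "0 < L" and t: "0 < t" and R: "0 < R" "2 * real R powr t + 2 * real N \<le> real R"
    and bad: "\<And>n a. {a..a + L / real R ^ n} \<subseteq> {a0..a0 + L} \<Longrightarrow>
       \<exists>F. finite F \<and> card F \<le> N \<and> (\<forall>S\<in>F. \<forall>u\<in>S. \<forall>v\<in>S. \<bar>u - v\<bar> < L / real R ^ Suc n)
            \<and> B n \<inter> {a..a + L / real R ^ n} \<subseteq> \<Union>F"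
    and w: "summable w" "\<And>i. 0 < w i" "suminf w < (L / R) powr t"
    and wU: "\<And>i u v. u \<in> U i \<Longrightarrow> v \<in> U i \<Longrightarrow> \<bar>u - v\<bar> powr t \<le> w i"
  shows "\<exists>q\<in>{a0..a0 + L}. \<forall>n. q \<notin> B n \<and> q \<notin> U n"
proof -
  define l where "l n = L / real R ^ n" for n
  define J where "J n a = {a..a + l n}" for n a
  define P where "P n a \<longleftrightarrow> J n a \<subseteq> {a0..a0 + L} \<and> load w U (J n a) < l (Suc n) powr t" for n a
  have lpos: "0 < l n" for n using L R by (simp add: l_def)
  have lSuc: "l n = real R * l (Suc n)" for n using R by (simp add: l_def)
  have "load w U X \<le> suminf w" for X
    unfolding load_def
    by (rule suminf_le[OF _ load_summable[OF w(1,2)] w(1)]) (use w(2) in \<open>auto intro: less_imp_le\<close>)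
  then have P0: "P 0 a0" using w(3) by (auto simp: P_def J_def l_def intro: le_less_trans)
  have step: "\<exists>a'. P (Suc n) a' \<and> (J (Suc n) a' \<subseteq> J n a \<and> J (Suc n) a' \<inter> B n = {})" if "P n a" for n a
  proof -
    from that have J0: "J n a \<subseteq> {a0..a0 + L}" and ld: "load w U (J n a) < l (Suc n) powr t"
      by (auto simp: P_def)
    obtain F where F: "finite F" "card F \<le> N" "\<forall>S\<in>F. \<forall>u\<in>S. \<forall>v\<in>S. \<bar>u - v\<bar> < l (Suc n)"
      "B n \<inter> J n a \<subseteq> \<Union>F"
      using bad[OF J0[unfolded J_def l_def]] unfolding J_def l_def by metis
    have thin: "\<bar>u - v\<bar> < l (Suc n)" if i: "U i \<inter> J n a \<noteq> {}" "u \<in> U i" "v \<in> U i" for i u v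
    proof (rule ccontr)
      assume "\<not> ?thesis"
      then have "l (Suc n) powr t \<le> \<bar>u - v\<bar> powr t" using lpos[of "Suc n"] t by (intro powr_mono2) auto
      also have "\<dots> \<le> w i" by (rule wU) (use i in auto)
      also have "\<dots> \<le> load w U (J n a)" by (rule weight_le_load) (use w i in auto)
      finally show False using ld by simp
    qed
    have "\<exists>k<R. (\<Union>F) \<inter> {a + real k * l (Suc n) .. a + real k * l (Suc n) + l (Suc n)} = {}
           \<and> 2 * real R powr t * load w U {a + real k * l (Suc n) .. a + real k * l (Suc n) + l (Suc n)} \<le> 2 * load w U (J n a)"
    proof (rule exists_light_child)
      show "J n a = {a..a + real R * l (Suc n)}" by (simp add: J_def lSuc[of n])
      show "2 * real R powr t + 2 * real (card F) \<le> real R" using R(2) F(2) by linarith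
    qed (use w lpos thin F R in auto)
    then obtain k where k: "k < R" and k1: "(\<Union>F) \<inter> J (Suc n) (a + real k * l (Suc n)) = {}"
      and k2: "2 * real R powr t * load w U (J (Suc n) (a + real k * l (Suc n))) \<le> 2 * load w U (J n a)"
      by (auto simp: J_def)
    define a' where "a' = a + real k * l (Suc n)"
    have "real (Suc k) * l (Suc n) \<le> real R * l (Suc n)"
      using k lpos[of "Suc n"] by (intro mult_right_mono) auto
    moreover have "0 \<le> real k * l (Suc n)" using lpos[of "Suc n"] by simp
    ultimately have sub: "J (Suc n) a' \<subseteq> J n a"
      by (auto simp: J_def a'_def lSuc[of n] algebra_simps)
    have "real R powr t * load w U (J (Suc n) a') < l (Suc n) powr t"
      using k2 ld by (simp add: a'_def)
    also have "\<dots> = real R powr t * l (Suc (Suc n)) powr t"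
      unfolding lSuc[of "Suc n"] by (rule powr_mult)
    finally have "load w U (J (Suc n) a') < l (Suc (Suc n)) powr t" using R(1) by simp
    then have "P (Suc n) a'" using sub J0 by (auto simp: P_def)
    moreover have "J (Suc n) a' \<inter> B n = {}" using k1 sub F(4) unfolding a'_def by blast
    ultimately show ?thesis using sub by blast
  qed
  obtain a where a: "\<And>n. P n (a n)"
    "\<And>n. J (Suc n) (a (Suc n)) \<subseteq> J n (a n) \<and> J (Suc n) (a (Suc n)) \<inter> B n = {}"
    using dependent_nat_choice[of P "\<lambda>n a a'. J (Suc n) a' \<subseteq> J n a \<and> J (Suc n) a' \<inter> B n = {}"] P0 step
    by metis
  obtain q where q: "\<And>n. q \<in> J n (a n)"
    using nested_intervals_point[of l a] a(2) lpos unfolding J_def by (meson less_imp_le)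
  have "q \<notin> B n" for n using a(2)[of n] q[of "Suc n"] by blast
  moreover have "q \<notin> U i" for i
  proof
    \<comment> \<open>A member of the cover that contains \<open>q\<close> is counted with its full weight at every level.\<close>
    assume "q \<in> U i"
    then have "w i \<le> l (Suc n) powr t" for n
      using weight_le_load[OF w(1,2), of U i "J n (a n)"] q[of n] a(1)[of n] unfolding P_def by fastforce
    moreover have "(\<lambda>n. l (Suc n) powr t) \<longlonglongrightarrow> 0"
    proof -
      have "2 * real R powr t \<ge> 2" using R(1) t by (simp add: ge_one_powr_ge_zero)
      then have "real R \<ge> 2" using R(2) by linarith
      then have "(\<lambda>n. L * (1 / real R) ^ n) \<longlonglongrightarrow> L * 0"
        by (intro tendsto_mult tendsto_const LIMSEQ_realpow_zero) auto
      then have "l \<longlonglongrightarrow> 0" by (simp add: l_def[abs_def] power_one_over field_simps)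
      then have "(\<lambda>n. l (Suc n)) \<longlonglongrightarrow> 0" by (rule LIMSEQ_Suc)
      then have "(\<lambda>n. l (Suc n) powr t) \<longlonglongrightarrow> 0 powr t"
        by (rule tendsto_powr2) (use t lpos in \<open>auto intro!: always_eventually less_imp_le\<close>)
      then show ?thesis using t by simp
    qed
    ultimately have "w i \<le> 0" by (intro LIMSEQ_le_const) auto
    then show False using w(2)[of i] by simp
  qed
  moreover have "q \<in> {a0..a0 + L}" using q[of 0] a(1)[of 0] by (auto simp: P_def)
  ultimately show ?thesis by blast
qed

section \<open>Ambiguous prefixes\<close>

text \<open>
  The value of the first \<open>n\<close> digits alone; the remainder \<open>x - prefix_value d n q\<close> has to be expanded by the
  digits from index \<open>n\<close> on.
\<close>

definition prefix_value :: "(nat \<Rightarrow> nat) \<Rightarrow> nat \<Rightarrow> real \<Rightarrow> real" where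
  "prefix_value d n q = (\<Sum>j<n. real (d j) / q ^ Suc j)"

text \<open>
  The rescaled remainder \<open>y\<close> after the last digit lies in the overlap
  \<open>[0, M/(q-1) - 1]\<close>, which means that both \<open>y\<close> and \<open>y + 1\<close> are in the range \<open>[0, M/(q-1)]\<close> of
  expandable numbers: the digit \<open>d m\<close> and the digit \<open>d m - 1\<close> are both possible.
\<close>

definition ambiguous_prefix :: "nat \<Rightarrow> real \<Rightarrow> real \<Rightarrow> nat \<Rightarrow> (nat \<Rightarrow> nat) \<Rightarrow> bool" where
  "ambiguous_prefix M x q m d \<longleftrightarrow>
     (\<forall>j\<le>m. d j \<le> M) \<and> 1 \<le> d m \<and> 0 \<le> x - prefix_value d (Suc m) q \<and>
     x - prefix_value d (Suc m) q \<le> (real M / (q - 1) - 1) / q ^ Suc m"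

definition first_ambiguity :: "nat \<Rightarrow> real \<Rightarrow> real \<Rightarrow> nat \<Rightarrow> bool" where
  "first_ambiguity M x q m \<longleftrightarrow>
     (\<exists>d. ambiguous_prefix M x q m d) \<and> (\<forall>k<m. \<nexists>d. ambiguous_prefix M x q k d)"

lemma prefix_value_Suc: "prefix_value d (Suc n) q = prefix_value d n q + real (d n) / q ^ Suc n"
  by (simp add: prefix_value_def)

lemma prefix_value_cong: "(\<And>j. j < n \<Longrightarrow> d j = e j) \<Longrightarrow> prefix_value d n q = prefix_value e n q"
  unfolding prefix_value_def by (intro sum.cong) auto

lemma prefix_value_mono: "0 < q \<Longrightarrow> m \<le> n \<Longrightarrow> prefix_value d m q \<le> prefix_value d n q"
  unfolding prefix_value_def by (intro sum_mono2) auto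

text \<open>
  The bound is the value of the block that has the digit \<open>M\<close> in all places \<open>a, \<dots>, b - 1\<close>.
\<close>

lemma prefix_value_tail_le:
  assumes "1 < q" "a \<le> b" "\<And>j. j < b \<Longrightarrow> d j \<le> M"
  shows "prefix_value d b q - prefix_value d a q \<le> real M / (q - 1) * (1 / q ^ a - 1 / q ^ b)"
  using assms(2,3)
proof (induction rule: dec_induct)
  case base then show ?case by simp
next
  case (step n)
  have "real (d n) / q ^ Suc n \<le> real M / q ^ Suc n"
    using step.prems assms(1) by (intro divide_right_mono) auto
  moreover have "real M / q ^ Suc n = real M / (q - 1) * (1 / q ^ n - 1 / q ^ Suc n)"
    using assms(1) by (simp add: field_simps)
  ultimately show ?case using step by (simp add: prefix_value_Suc algebra_simps)
qed

lemma expansion_remainder: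
  assumes q: "1 < q" and e: "is_expansion M q x d"
  shows "0 \<le> x - prefix_value d n q" "x - prefix_value d n q \<le> real M / (q - 1) / q ^ n"
proof -
  have d: "\<And>i. d i \<le> M" and s: "(\<lambda>i. real (d i) / q ^ Suc i) sums x"
    using e by (auto simp: is_expansion_def)
  have lim: "(\<lambda>k. prefix_value d k q) \<longlonglongrightarrow> x"
    using s by (simp add: sums_def prefix_value_def)
  have "prefix_value d n q \<le> prefix_value d k q" if "n \<le> k" for k
    using that q by (intro prefix_value_mono) auto
  then have "prefix_value d n q \<le> x"
    by (intro LIMSEQ_le_const[OF lim] exI[of _ n]) blast
  then show "0 \<le> x - prefix_value d n q" by simp
  have "prefix_value d k q \<le> prefix_value d n q + real M / (q - 1) / q ^ n" if "n \<le> k" for k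
  proof -
    have "real M / (q - 1) * (1 / q ^ n - 1 / q ^ k) \<le> real M / (q - 1) * (1 / q ^ n)"
      using q by (intro mult_left_mono) auto
    then show ?thesis using prefix_value_tail_le[OF q that, where d = d and M = M, OF d] by simp
  qed
  then have "x \<le> prefix_value d n q + real M / (q - 1) / q ^ n"
    by (intro LIMSEQ_le_const2[OF lim] exI[of _ n]) blast
  then show "x - prefix_value d n q \<le> real M / (q - 1) / q ^ n" by simp
qed

text \<open>
  At the first place where two expansions differ, the one with the larger digit has a nonnegative
  remainder, and the other one bounds this remainder from above because its own remainder is
  expandable.
\<close>

lemma ambiguous_prefix_of_two_expansions:
  assumes q: "1 < q" and d: "is_expansion M q x d" and e: "is_expansion M q x e" and "d \<noteq> e"
  shows "\<exists>m d. ambiguous_prefix M x q m d"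
proof -
  have main: "ambiguous_prefix M x q m d" if d: "is_expansion M q x d" and e: "is_expansion M q x e"
    and m: "\<And>j. j < m \<Longrightarrow> d j = e j" "e m < d m" for d e m
  proof -
    have "prefix_value e (Suc m) q + 1 / q ^ Suc m \<le> prefix_value d (Suc m) q"
    proof -
      have "prefix_value d m q = prefix_value e m q" using m(1) by (rule prefix_value_cong)
      moreover have "(real (e m) + 1) / q ^ Suc m \<le> real (d m) / q ^ Suc m"
        using m(2) q by (intro divide_right_mono) auto
      ultimately show ?thesis by (simp add: prefix_value_Suc add_divide_distrib)
    qed
    then have "x - prefix_value d (Suc m) q \<le> (real M / (q - 1) - 1) / q ^ Suc m"
      using expansion_remainder(2)[OF q e, of "Suc m"] by (simp add: diff_divide_distrib)
    then show ?thesis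
      using expansion_remainder(1)[OF q d, of "Suc m"] d m(2) by (auto simp: ambiguous_prefix_def is_expansion_def)
  qed
  have "\<exists>m. d m \<noteq> e m" using \<open>d \<noteq> e\<close> by auto
  then obtain m where m: "d m \<noteq> e m" "\<And>j. j < m \<Longrightarrow> d j = e j"
    using exists_least_iff[of "\<lambda>m. d m \<noteq> e m"] by blast
  then consider "e m < d m" | "d m < e m" by linarith
  then show ?thesis using main[OF d e m(2)] main[OF e d] m(2) by cases (blast, metis)
qed

text \<open>
  The greedy algorithm. Its rescaled remainders stay in \<open>[0, M/(q-1)]\<close>, where \<open>q \<le> M + 1\<close> is needed to get
  a next remainder below \<open>1 \<le> M/(q-1)\<close> when the digit is not capped at \<open>M\<close>.
\<close>

lemma expansion_exists:
  assumes q: "1 < q" "q \<le> real M + 1" and x: "0 \<le> x" "x \<le> 1"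
  shows "\<exists>d. is_expansion M q x d"
proof -
  define dig where "dig t = min M (nat \<lfloor>q * t\<rfloor>)" for t
  define r where "r = rec_nat x (\<lambda>_ t. q * t - real (dig t))"
  have r0: "r 0 = x" and rS: "r (Suc n) = q * r n - real (dig (r n))" for n
    by (simp_all add: r_def)
  define c where "c = real M / (q - 1)"
  have c: "1 \<le> c" "q * c = c + real M" using q by (simp_all add: c_def field_simps)
  have bd: "0 \<le> r n \<and> r n \<le> c" for n
  proof (induction n)
    case 0 then show ?case using x c by (simp add: r0)
  next
    case (Suc n)
    have qr: "0 \<le> q * r n" "q * r n \<le> c + real M"
      using Suc q mult_left_mono[of "r n" c q] c by auto
    show ?case
    proof (cases "\<lfloor>q * r n\<rfloor> \<le> int M")
      case True
      then have "real (dig (r n)) = of_int \<lfloor>q * r n\<rfloor>" using qr(1) by (simp add: dig_def min.absorb2 nat_le_iff)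
      then show ?thesis unfolding rS using c(1) by linarith
    next
      case False
      then have "dig (r n) = M" by (simp add: dig_def min_def)
      then show ?thesis unfolding rS using False qr by linarith
    qed
  qed
  define d where "d n = dig (r n)" for n
  have pv: "prefix_value d n q = x - r n / q ^ n" for n
  proof (induction n)
    case 0 then show ?case by (simp add: prefix_value_def r0)
  next
    case (Suc n)
    show ?case unfolding prefix_value_Suc Suc rS using q by (simp add: d_def diff_divide_distrib)
  qed
  have "(\<lambda>n. c * (1 / q) ^ n) \<longlonglongrightarrow> c * 0"
    using q by (intro tendsto_mult tendsto_const LIMSEQ_realpow_zero) auto
  moreover have "norm (r n / q ^ n) \<le> c * (1 / q) ^ n" for n
    using bd[of n] q by (simp add: power_one_over divide_right_mono)
  ultimately have "(\<lambda>n. r n / q ^ n) \<longlonglongrightarrow> 0"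
    by (intro Lim_null_comparison[of "\<lambda>n. r n / q ^ n" "\<lambda>n. c * (1 / q) ^ n"]) auto
  then have "(\<lambda>n. prefix_value d n q) \<longlonglongrightarrow> x - 0" unfolding pv by (intro tendsto_diff tendsto_const)
  then have "is_expansion M q x d"
    unfolding is_expansion_def sums_def prefix_value_def by (auto simp: d_def dig_def)
  then show ?thesis by blast
qed

lemma univoque_if_never_ambiguous:
  assumes q: "1 < q" "q \<le> real M + 1" and x: "0 \<le> x" "x \<le> 1"
    and no: "\<And>m. \<not> first_ambiguity M x q m"
  shows "q \<in> univoque_bases M x"
proof -
  have "\<not> ambiguous_prefix M x q m d" for m d
    using exists_least_iff[of "\<lambda>m. \<exists>d. ambiguous_prefix M x q m d"] no unfolding first_ambiguity_def by blast
  then have "\<exists>!d. is_expansion M q x d"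
    using expansion_exists[OF q x] ambiguous_prefix_of_two_expansions[OF q(1)] by blast
  then show ?thesis using q by (simp add: univoque_bases_def)
qed

text \<open>
  Otherwise the digit at \<open>j\<close> could be raised by one, and this would be an ambiguity at the level
  \<open>j < m\<close>. This is the only use of the minimality of \<open>m\<close>; it is what keeps the bases of distinct words
  apart.
\<close>

lemma first_ambiguity_remainder_less:
  assumes q: "1 < q" and f: "first_ambiguity M x q m" and d: "ambiguous_prefix M x q m d"
    and j: "j < m" "d j < M"
  shows "x - prefix_value d (Suc j) q < 1 / q ^ Suc j"
proof (rule ccontr)
  assume "\<not> ?thesis"
  then have ge: "1 / q ^ Suc j \<le> x - prefix_value d (Suc j) q" by simp
  define e where "e = d(j := Suc (d j))"
  have e: "prefix_value e (Suc j) q = prefix_value d (Suc j) q + 1 / q ^ Suc j"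
    using prefix_value_cong[of j e d q] by (simp add: prefix_value_Suc e_def add_divide_distrib)
  define c where "c = real M / (q - 1)"
  have dM: "\<And>i. i < Suc m \<Longrightarrow> d i \<le> M" and up: "x - prefix_value d (Suc m) q \<le> (c - 1) / q ^ Suc m"
    using d by (auto simp: ambiguous_prefix_def c_def)
  have "prefix_value d (Suc m) q - prefix_value d (Suc j) q \<le> c * (1 / q ^ Suc j - 1 / q ^ Suc m)"
    unfolding c_def by (rule prefix_value_tail_le[OF q _ dM]) (use j in auto)
  moreover have "(c - 1) / q ^ Suc m \<le> c / q ^ Suc m" using q by (intro divide_right_mono) auto
  ultimately have "x - prefix_value d (Suc j) q \<le> c / q ^ Suc j" using up by (simp add: algebra_simps)
  then have "ambiguous_prefix M x q j e"
    using ge dM j e unfolding ambiguous_prefix_def c_def[symmetric]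
    by (auto simp: e_def diff_divide_distrib Suc_le_eq less_imp_le)
  then show False using f j by (auto simp: first_ambiguity_def)
qed

section \<open>Dependence on the base\<close>

text \<open>
  Termwise comparison with the sequence that is constantly \<open>M\<close>, whose value is \<open>M/(q-1)\<close> in base
  \<open>q\<close>; so the bound does not depend on \<open>n\<close>.
\<close>

lemma prefix_value_diff_le:
  assumes q: "1 < q" "q \<le> q'" and d: "\<And>j. j < n \<Longrightarrow> d j \<le> M"
  shows "prefix_value d n q - prefix_value d n q' \<le> real M * (q' - q) / ((q - 1) * (q' - 1))"
proof -
  have geo: "(\<lambda>j. 1 / p ^ Suc j) sums (1 / (p - 1))" if "1 < p" for p :: real
    using sums_mult[OF geometric_sums[of "1 / p"], of "1 / p"] that by (simp add: power_one_over field_simps)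
  have s: "(\<lambda>j. real M * (1 / q ^ Suc j - 1 / q' ^ Suc j)) sums (real M * (1 / (q - 1) - 1 / (q' - 1)))"
    using q by (intro sums_mult sums_diff geo) auto
  have nn: "0 \<le> 1 / q ^ Suc j - 1 / q' ^ Suc j" for j
  proof -
    have "q ^ Suc j \<le> q' ^ Suc j" using q by (intro power_mono) auto
    then have "1 / q' ^ Suc j \<le> 1 / q ^ Suc j" using q by (intro divide_left_mono mult_pos_pos zero_less_power) auto
    then show ?thesis by simp
  qed
  have "prefix_value d n q - prefix_value d n q' = (\<Sum>j<n. real (d j) * (1 / q ^ Suc j - 1 / q' ^ Suc j))"
    unfolding prefix_value_def sum_subtractf[symmetric] by (simp add: algebra_simps)
  also have "\<dots> \<le> (\<Sum>j<n. real M * (1 / q ^ Suc j - 1 / q' ^ Suc j))"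
    using d nn by (intro sum_mono mult_right_mono) auto
  also have "\<dots> \<le> (\<Sum>j. real M * (1 / q ^ Suc j - 1 / q' ^ Suc j))"
    using nn by (intro sum_le_suminf sums_summable[OF s]) auto
  also have "\<dots> = real M * (1 / (q - 1) - 1 / (q' - 1))" using s by (rule sums_unique[symmetric])
  also have "\<dots> = real M * (q' - q) / ((q - 1) * (q' - 1))" using q by (simp add: field_simps)
  finally show ?thesis .
qed

text \<open>
  Each summand is a multiple of a power \<open>q\<^bsup>-(j+1)\<^esup>\<close> with \<open>j + 1 \<ge> 1\<close>, hence decreases at least as
  fast, in relative terms, as \<open>1/q\<close> does.
\<close>

lemma prefix_value_diff_ge:
  assumes q: "0 < q" "q \<le> q'"
  shows "prefix_value d n q * (q' - q) / q' \<le> prefix_value d n q - prefix_value d n q'"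
proof -
  have "real (d j) / q ^ Suc j * ((q' - q) / q') \<le> real (d j) / q ^ Suc j - real (d j) / q' ^ Suc j" for j
  proof -
    have "q ^ j \<le> q' ^ j" using q by (intro power_mono) auto
    then have "real (d j) / q' ^ Suc j \<le> real (d j) / (q ^ j * q')"
      using q by (intro divide_left_mono) auto
    also have "\<dots> = real (d j) / q ^ Suc j - real (d j) / q ^ Suc j * ((q' - q) / q')"
      using q by (simp add: field_simps)
    finally show ?thesis by simp
  qed
  then have "(\<Sum>j<n. real (d j) / q ^ Suc j * ((q' - q) / q')) \<le> (\<Sum>j<n. real (d j) / q ^ Suc j - real (d j) / q' ^ Suc j)"
    by (rule sum_mono)
  then show ?thesis unfolding prefix_value_def sum_subtractf sum_distrib_right[symmetric] by simp
qed

section \<open>Bases with an ambiguity at a given level are sparse\<close>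

text \<open>
  Let \<open>j\<close> be the first place where the words differ, with the larger digit on the side of \<open>q\<close>. Read the
  larger prefix, up to and including \<open>j\<close>, in both bases. In base \<open>q\<close> its value falls short of \<open>x\<close> by at least
  the contribution \<open>q\<^bsup>-(m+1)\<^esup>\<close> of the nonzero last digit if \<open>j < m\<close>. In base \<open>q'\<close> it exceeds \<open>x\<close>, since the
  remainder after the smaller digit is less than one unit of that place. So the value of one
  prefix changes by about \<open>q\<^bsup>-(m+1)\<^esup>\<close> between the two bases, and its slope is at most \<open>4 M\<close>. If \<open>j = m\<close>, half
  of this gap comes from the place \<open>m\<close> itself, as the overlap is at most half a unit long.
\<close>

lemma ambiguous_points_of_distinct_words_separated:
  assumes q: "3/2 \<le> q" "3/2 \<le> q'"
    and amb: "first_ambiguity M x q m" "ambiguous_prefix M x q m d"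
      "first_ambiguity M x q' m" "ambiguous_prefix M x q' m d'"
    and differ: "\<exists>j\<le>m. d j \<noteq> d' j"
    and small: "real M / (q - 1) - 1 \<le> 1/2" "real M / (q' - 1) - 1 \<le> 1/2"
    and h: "0 \<le> h" "h \<le> 1 / q ^ Suc m" "h \<le> 1 / q' ^ Suc m"
  shows "h / 2 \<le> 4 * real M * \<bar>q - q'\<bar>"
proof -
  have main: "h / 2 \<le> 4 * real M * \<bar>p - p'\<bar>"
    if p: "3/2 \<le> p" "3/2 \<le> p'" and amb: "ambiguous_prefix M x p m e"
      "first_ambiguity M x p' m" "ambiguous_prefix M x p' m e'"
      and small: "real M / (p' - 1) - 1 \<le> 1/2"
      and h: "h \<le> 1 / p ^ Suc m" "h \<le> 1 / p' ^ Suc m"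
      and j: "j \<le> m" "\<And>i. i < j \<Longrightarrow> e i = e' i" "e' j < e j" for p p' e e' j
  proof -
    have eM: "e i \<le> M" if "i < Suc j" for i using amb(1) j(1) that by (auto simp: ambiguous_prefix_def)
    have shift: "prefix_value e' (Suc j) p' + 1 / p' ^ Suc j \<le> prefix_value e (Suc j) p'"
    proof -
      have "prefix_value e j p' = prefix_value e' j p'" using j(2) by (rule prefix_value_cong)
      moreover have "(real (e' j) + 1) / p' ^ Suc j \<le> real (e j) / p' ^ Suc j"
        using j(3) p by (intro divide_right_mono) auto
      ultimately show ?thesis by (simp add: prefix_value_Suc add_divide_distrib)
    qed
    have "h / 2 \<le> prefix_value e (Suc j) p' - prefix_value e (Suc j) p"
    proof (cases "j = m")
      case True
      define y where "y = 1 / p' ^ Suc m"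
      have "x - prefix_value e' (Suc m) p' \<le> (real M / (p' - 1) - 1) / p' ^ Suc m"
        using amb(3) unfolding ambiguous_prefix_def by blast
      also have "\<dots> \<le> (1 / 2) / p' ^ Suc m"
        using small p by (intro divide_right_mono) auto
      also have "\<dots> = y / 2" by (simp add: y_def)
      finally have "x - prefix_value e' (Suc m) p' \<le> y / 2" .
      moreover have "0 \<le> x - prefix_value e (Suc m) p" using amb(1) by (auto simp: ambiguous_prefix_def)
      ultimately show ?thesis using shift h(2) unfolding True y_def[symmetric] by linarith
    next
      case False
      then have jm: "j < m" using j(1) by simp
      have "x - prefix_value e' (Suc j) p' < 1 / p' ^ Suc j"
        by (rule first_ambiguity_remainder_less[OF _ amb(2,3) jm])
           (use p j(3) eM[of j] in auto)
      moreover have "prefix_value e (Suc j) p \<le> prefix_value e m p"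
        using p jm by (intro prefix_value_mono) auto
      moreover have "1 / p ^ Suc m \<le> real (e m) / p ^ Suc m"
        using amb(1) p by (intro divide_right_mono) (auto simp: ambiguous_prefix_def)
      moreover have "0 \<le> x - prefix_value e (Suc m) p" using amb(1) by (auto simp: ambiguous_prefix_def)
      ultimately show ?thesis using shift h(1) \<open>0 \<le> h\<close> unfolding prefix_value_Suc[of e m] by linarith
    qed
    also have "\<dots> \<le> 4 * real M * \<bar>p - p'\<bar>"
    proof (cases "p' \<le> p")
      case True
      have "prefix_value e (Suc j) p' - prefix_value e (Suc j) p \<le> real M * (p - p') / ((p' - 1) * (p - 1))"
        by (rule prefix_value_diff_le) (use p True eM in auto)
      also have "\<dots> \<le> real M * (p - p') / (1 / 2 * (1 / 2))"
        using p True by (intro divide_left_mono mult_mono mult_nonneg_nonneg mult_pos_pos) auto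
      finally show ?thesis using True by simp
    next
      case False
      then have "prefix_value e (Suc j) p * (p' - p) / p' \<le> prefix_value e (Suc j) p - prefix_value e (Suc j) p'"
        using p by (intro prefix_value_diff_ge) auto
      moreover have "0 \<le> prefix_value e (Suc j) p * (p' - p) / p'"
        using False p by (simp add: prefix_value_def sum_nonneg)
      ultimately have "prefix_value e (Suc j) p' - prefix_value e (Suc j) p \<le> 0" by linarith
      then show ?thesis by (rule order_trans) simp
    qed
    finally show ?thesis .
  qed
  obtain j where j: "j \<le> m" "d j \<noteq> d' j" "\<And>i. i < j \<Longrightarrow> d i = d' i"
    using differ exists_least_iff[of "\<lambda>j. d j \<noteq> d' j \<and> j \<le> m"] by (metis less_trans less_imp_le order_trans)
  show ?thesis
  proof (cases "d' j < d j")
    case True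
    show ?thesis by (rule main[OF q amb(2,3,4) small(2) h(2,3) j(1,3) True])
  next
    case False
    then have "d j < d' j" using j(2) by simp
    from main[OF q(2,1) amb(4,1,2) small(1) h(3,2) j(1) j(3)[symmetric] this]
    show ?thesis by (simp add: abs_minus_commute)
  qed
qed

text \<open>
  The value of the word is at most \<open>x\<close> in base \<open>q\<close> and at least \<open>x - \<rho> q'\<^bsup>-(m+1)\<^esup>\<close> in base \<open>q'\<close>,
  whereas it drops with a slope of order \<open>x\<close> at least.
\<close>

lemma ambiguous_points_of_same_word_close:
  assumes q: "1 < q" "q \<le> q'" "q' \<le> b"
    and amb: "ambiguous_prefix M x q m d" "ambiguous_prefix M x q' m d"
    and \<rho>: "real M / (q' - 1) - 1 \<le> \<rho>" "0 \<le> \<rho>" "\<rho> \<le> x / 2"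
  shows "x / 2 * (q' - q) \<le> b * \<rho> / q' ^ Suc m"
proof -
  define V where "V = prefix_value d (Suc m)"
  have "(real M / (q' - 1) - 1) / q' ^ Suc m \<le> \<rho> / q' ^ Suc m"
    using \<rho>(1) q by (intro divide_right_mono) auto
  then have V': "x - V q' \<le> \<rho> / q' ^ Suc m" using amb(2) by (auto simp: ambiguous_prefix_def V_def)
  have "1 \<le> q' ^ Suc m" using q by (intro one_le_power) auto
  then have "\<rho> / q' ^ Suc m \<le> \<rho> / 1" using \<rho>(2) by (intro divide_left_mono) auto
  then have "x / 2 \<le> V q'" using V' \<rho>(3) by linarith
  have ge: "V q * (q' - q) / q' \<le> V q - V q'"
    unfolding V_def by (rule prefix_value_diff_ge) (use q in auto)
  have Vnn: "0 \<le> V q" using prefix_value_mono[of q 0 "Suc m" d] q by (simp add: V_def prefix_value_def[of _ 0])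
  then have "0 \<le> V q * (q' - q) / q'" using q by simp
  then have "x / 2 \<le> V q" using ge \<open>x / 2 \<le> V q'\<close> by linarith
  moreover have "V q \<le> x" using amb(1) by (auto simp: ambiguous_prefix_def V_def)
  ultimately have "V q * (q' - q) / q' \<le> \<rho> / q' ^ Suc m" using ge V' by linarith
  then have "V q * (q' - q) \<le> q' * (\<rho> / q' ^ Suc m)" using q by (simp add: pos_divide_le_eq mult.commute)
  also have "\<dots> \<le> b * (\<rho> / q' ^ Suc m)" using q \<rho>(2) by (intro mult_right_mono) auto
  finally have "V q * (q' - q) \<le> b * \<rho> / q' ^ Suc m" by simp
  moreover have "x / 2 * (q' - q) \<le> V q * (q' - q)" using \<open>x / 2 \<le> V q\<close> q by (intro mult_right_mono) auto
  ultimately show ?thesis by linarith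
qed

lemma ambiguous_prefix_imp_pos:
  assumes "0 < q" "ambiguous_prefix M x q m d"
  shows "0 < x"
proof -
  have "0 < real (d m) / q ^ Suc m" using assms by (auto simp: ambiguous_prefix_def)
  moreover have "0 \<le> prefix_value d m q"
    using prefix_value_mono[of q 0 m d] assms(1) by (simp add: prefix_value_def[of _ 0])
  ultimately show ?thesis using assms(2) by (auto simp: ambiguous_prefix_def prefix_value_Suc)
qed

text \<open>
  The two previous lemmas combined, for bases whose scale \<open>q\<^bsup>-(m+1)\<^esup>\<close> matches the length \<open>l\<close> of the interval in
  which they lie. The constant \<open>1 / (32 M)\<close> makes \<open>l\<close> shorter than the gap between distinct words, so
  only one word occurs. The overlap \<open>\<rho>\<close> is so small that the bases of this word fit into a child
  of length \<open>l / R\<close>.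
\<close>

lemma first_ambiguities_thin:
  fixes M m R :: nat and l x :: real
  assumes M: "1 \<le> M" and R: "1 \<le> R" and l: "0 < l"
    and q: "3/2 \<le> q" "q \<le> real M + 1" "3/2 \<le> q'" "q' \<le> real M + 1" "\<bar>q - q'\<bar> \<le> l"
    and amb: "first_ambiguity M x q m" "first_ambiguity M x q' m"
    and win: "1 / (32 * real M) / real R \<le> l * q ^ Suc m" "l * q ^ Suc m < 1 / (32 * real M)"
      "1 / (32 * real M) / real R \<le> l * q' ^ Suc m" "l * q' ^ Suc m < 1 / (32 * real M)"
    and \<rho>: "real M / (q - 1) - 1 \<le> \<rho>" "real M / (q' - 1) - 1 \<le> \<rho>" "0 \<le> \<rho>" "\<rho> \<le> 1/2"
      "64 * real M * (real M + 1) * real R ^ 2 * \<rho> < x"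
  shows "\<bar>q - q'\<bar> < l / real R"
proof -
  obtain d d' where d: "ambiguous_prefix M x q m d" and d': "ambiguous_prefix M x q' m d'"
    using amb by (auto simp: first_ambiguity_def)
  have h: "32 * real M * l \<le> 1 / p ^ Suc m" if "3/2 \<le> p" "l * p ^ Suc m < 1 / (32 * real M)" for p
    using that M by (simp add: field_simps)
  show ?thesis
  proof (cases "\<exists>j\<le>m. d j \<noteq> d' j")
    case True
    have "32 * real M * l / 2 \<le> 4 * real M * \<bar>q - q'\<bar>"
      by (rule ambiguous_points_of_distinct_words_separated[OF q(1,3) amb(1) d amb(2) d' True])
         (use h[OF q(1) win(2)] h[OF q(3) win(4)] l order_trans[OF \<rho>(1,4)] order_trans[OF \<rho>(2,4)] in \<open>simp_all del: power_Suc\<close>)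
    then have "4 * l \<le> \<bar>q - q'\<bar>" using M by simp
    then show ?thesis using q(5) l by linarith
  next
    case False
    then have "prefix_value d' (Suc m) q' = prefix_value d (Suc m) q'" by (intro prefix_value_cong) auto
    then have d2: "ambiguous_prefix M x q' m d" using d' False by (simp add: ambiguous_prefix_def)
    have x: "0 < x" by (rule ambiguous_prefix_imp_pos[OF _ d]) (use q in auto)
    have two: "2 * 1 * 1 * 1 \<le> 64 * real M * (real M + 1) * real R ^ 2"
      using M R by (intro mult_mono) auto
    have "2 * 1 * 1 * 1 * \<rho> < x" by (rule le_less_trans[OF mult_right_mono[OF two \<rho>(3)] \<rho>(5)])
    then have \<rho>x: "\<rho> \<le> x / 2" by simp
    have up: "1 / p ^ Suc m \<le> 32 * real M * real R * l" if "3/2 \<le> p" "1 / (32 * real M) / real R \<le> l * p ^ Suc m" for p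
      using that M R by (simp add: field_simps)
    have main: "\<bar>q - q'\<bar> * x \<le> 2 * ((real M + 1) * \<rho>) * (32 * real M * real R * l)"
    proof (cases "q \<le> q'")
      case True
      have "x / 2 * (q' - q) \<le> (real M + 1) * \<rho> / q' ^ Suc m"
        by (rule ambiguous_points_of_same_word_close[OF _ True q(4) d d2 \<rho>(2,3) \<rho>x]) (use q in auto)
      also have "\<dots> = (real M + 1) * \<rho> * (1 / q' ^ Suc m)" by simp
      also have "\<dots> \<le> (real M + 1) * \<rho> * (32 * real M * real R * l)"
        using \<rho>(3) by (intro mult_left_mono up q win) auto
      finally show ?thesis using True by (simp add: algebra_simps)
    next
      case False
      have "x / 2 * (q - q') \<le> (real M + 1) * \<rho> / q ^ Suc m"
        by (rule ambiguous_points_of_same_word_close[OF _ _ q(2) d2 d \<rho>(1,3) \<rho>x]) (use q False in auto)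
      also have "\<dots> = (real M + 1) * \<rho> * (1 / q ^ Suc m)" by simp
      also have "\<dots> \<le> (real M + 1) * \<rho> * (32 * real M * real R * l)"
        using \<rho>(3) by (intro mult_left_mono up q win) auto
      finally show ?thesis using False by (simp add: algebra_simps)
    qed
    have "\<bar>q - q'\<bar> * real R * x \<le> 64 * real M * (real M + 1) * real R ^ 2 * \<rho> * l"
      using mult_right_mono[OF main, of "real R"] by (simp add: algebra_simps power2_eq_square)
    also have "\<dots> < x * l" using \<rho>(5) l by (rule mult_strict_right_mono)
    finally have "\<bar>q - q'\<bar> * real R < l" using x by (simp add: mult.commute)
    then show ?thesis using R by (simp add: pos_less_divide_eq)
  qed
qed

text \<open>
  Bernoulli's inequality for \<open>a / q\<close>. It permits changing the base of a power as long as the exponent is at most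
  of the order of the inverse distance.
\<close>

lemma power_ge_half_of_close:
  fixes a q :: real
  assumes "0 \<le> a" "a \<le> q" "1 \<le> q" "real n * (q - a) \<le> 1/2"
  shows "q ^ n \<le> 2 * a ^ n"
proof -
  have e: "a / q = 1 + - ((q - a) / q)" using assms by (simp add: field_simps)
  have "(q - a) / q \<le> (q - a) / 1" using assms by (intro divide_left_mono) auto
  then have "real n * ((q - a) / q) \<le> real n * (q - a)" by (intro mult_left_mono) auto
  then have "1 / 2 \<le> 1 + real n * - ((q - a) / q)" using assms by simp
  also have "\<dots> \<le> (1 + - ((q - a) / q)) ^ n"
    by (rule Bernoulli_inequality) (use assms in \<open>simp add: field_simps\<close>)
  also have "\<dots> = a ^ n / q ^ n" unfolding e[symmetric] by (rule power_divide)
  finally show ?thesis using assms by (simp add: field_simps)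
qed

text \<open>
  For a single base the levels \<open>m\<close> in question satisfy \<open>\<theta>/R \<le> l q\<^bsup>m+1\<^esup> < \<theta>\<close> and number about \<open>log R\<close>. Inside an
  interval of length \<open>l\<close> the base varies, but \<open>l\<close> is exponentially small in \<open>m\<close>, so \<open>q\<^bsup>m+1\<^esup>\<close>
  can be replaced by the power of the left endpoint at the cost of a factor 2.
\<close>

lemma card_window_le:
  fixes a l \<theta> :: real and R K :: nat
  assumes a: "3/2 \<le> a" and l: "0 < l" and \<theta>: "0 < \<theta>" "\<theta> \<le> 1/4" and R: "1 \<le> R" and K: "2 * real R \<le> (3/2) ^ K"
  defines "A \<equiv> {m. \<exists>q\<in>{a..a + l}. \<theta> / real R \<le> l * q ^ Suc m \<and> l * q ^ Suc m < \<theta>}"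
  shows "finite A \<and> card A \<le> K"
proof -
  have left: "\<theta> / (2 * real R) \<le> l * a ^ Suc m \<and> l * a ^ Suc m < \<theta>" if "m \<in> A" for m
  proof -
    from that obtain q where q: "a \<le> q" "q \<le> a + l" "\<theta> / real R \<le> l * q ^ Suc m" "l * q ^ Suc m < \<theta>"
      by (auto simp: A_def)
    have "real (Suc m) \<le> 2 * (1 + real (Suc m) * (1/2))" by (simp add: field_simps)
    also have "\<dots> \<le> 2 * (1 + 1/2) ^ Suc m" by (intro mult_left_mono Bernoulli_inequality) simp_all
    also have "\<dots> \<le> 2 * q ^ Suc m" using a q by (intro mult_left_mono power_mono) auto
    finally have "real (Suc m) \<le> 2 * q ^ Suc m" .
    then have "real (Suc m) * (q - a) \<le> 2 * q ^ Suc m * l" using a q l by (intro mult_mono) auto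
    then have "real (Suc m) * (q - a) \<le> 1/2" using q(4) \<theta> by (simp add: mult.commute)
    then have "q ^ Suc m \<le> 2 * a ^ Suc m" using a q by (intro power_ge_half_of_close) auto
    then have "l * q ^ Suc m \<le> l * (2 * a ^ Suc m)" using l by (intro mult_left_mono) auto
    then have "\<theta> / real R \<le> 2 * (l * a ^ Suc m)" using q(3) by linarith
    moreover have "l * a ^ Suc m \<le> l * q ^ Suc m" using l a q by (intro mult_left_mono power_mono) auto
    moreover have "\<theta> / (2 * real R) = \<theta> / real R / 2" by simp
    ultimately show ?thesis using q(4) by linarith
  qed
  show ?thesis
  proof (cases "A = {}")
    case False
    define m0 where "m0 = (LEAST m. m \<in> A)"
    have m0: "m0 \<in> A" "\<And>m. m \<in> A \<Longrightarrow> m0 \<le> m"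
      using False unfolding m0_def by (auto intro: LeastI Least_le)
    have "A \<subseteq> {m0..<m0 + K}"
    proof
      fix m assume m: "m \<in> A"
      have "m < m0 + K"
      proof (rule ccontr)
        assume "\<not> ?thesis"
        then have mk: "m0 + K \<le> m" by simp
        have "\<theta> = \<theta> / (2 * real R) * (2 * real R)" using R by simp
        also have "\<dots> \<le> l * a ^ Suc m0 * (3/2) ^ K"
          using left[OF m0(1)] K R \<theta> l a by (intro mult_mono) auto
        also have "\<dots> \<le> l * a ^ Suc m0 * a ^ K"
          using a l by (intro mult_left_mono power_mono) auto
        also have "\<dots> = l * a ^ (Suc m0 + K)" by (simp add: power_add)
        also have "\<dots> \<le> l * a ^ Suc m" using mk a l by (intro mult_left_mono power_increasing) auto
        finally show False using left[OF m] by simp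
      qed
      then show "m \<in> {m0..<m0 + K}" using m0(2)[OF m] by simp
    qed
    then show ?thesis using card_mono[of "{m0..<m0 + K}" A] finite_subset by auto
  qed auto
qed

section \<open>Terminating expansions in base M + 1\<close>

lemma prefix_value_integral:
  assumes "0 < b" "n \<le> s"
  shows "prefix_value d n (real b) * real b ^ s \<in> \<int>"
proof -
  have "real (d j) / real b ^ Suc j * real b ^ s \<in> \<int>" if "j < n" for j
  proof -
    have "real b ^ s = real b ^ Suc j * real b ^ (s - Suc j)"
      unfolding power_add[symmetric] using that assms by simp
    then have "real (d j) / real b ^ Suc j * real b ^ s = real (d j * b ^ (s - Suc j))"
      using assms by simp
    then show ?thesis by (metis Ints_of_nat)
  qed
  then show ?thesis unfolding prefix_value_def sum_distrib_right by (intro Ints_sum) auto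
qed

lemma finite_expansions_prefix_value:
  assumes "x \<in> finite_expansions M"
  obtains d n where "x = prefix_value d n (real M + 1)" "\<And>j. j < n \<Longrightarrow> d j \<le> M"
proof -
  obtain d :: "nat \<Rightarrow> nat" and n where x: "x = (\<Sum>i = 1..n. real (d i) / (real M + 1) ^ i)" and d: "\<forall>i\<in>{1..n}. d i \<in> {0..M}"
    using assms unfolding finite_expansions_def by blast
  have "x = prefix_value (\<lambda>j. d (Suc j)) n (real M + 1)"
    unfolding x prefix_value_def by (simp add: sum.atLeast1_atMost_eq)
  then show ?thesis using d that by auto
qed

lemma finite_expansions_bounds:
  assumes "x \<in> finite_expansions M" "1 \<le> M"
  shows "0 \<le> x" "x \<le> 1"
proof -
  obtain d n where x: "x = prefix_value d n (real M + 1)" and d: "\<And>j. j < n \<Longrightarrow> d j \<le> M"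
    using finite_expansions_prefix_value[OF assms(1)] by metis
  show "0 \<le> x" unfolding x prefix_value_def by (intro sum_nonneg) auto
  have "prefix_value d n (real M + 1) - prefix_value d 0 (real M + 1)
     \<le> real M / (real M + 1 - 1) * (1 / (real M + 1) ^ 0 - 1 / (real M + 1) ^ n)"
    by (rule prefix_value_tail_le) (use d assms in auto)
  also have "\<dots> \<le> 1" using assms(2) by simp
  finally show "x \<le> 1" by (simp add: x prefix_value_def[of _ 0])
qed

text \<open>
  The arithmetic of terminating expansions enters here. Put \<open>b = M + 1\<close> and
  compare an ambiguous word in base \<open>q\<close> with the same word in base \<open>b\<close>. Its value in base \<open>b\<close> is strictly smaller
  than \<open>x\<close>, but only by \<open>O(\<delta>)\<close>, because \<open>b - q\<close> and the overlap are \<open>O(\<delta>)\<close>. The difference is an integer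
  multiple of \<open>b\<^bsup>-s\<^esup>\<close> with \<open>s = max (m + 1) n\<close>, so \<open>b\<^bsup>-s\<^esup> = O(\<delta>)\<close>. Since \<open>\<delta>\<close> is
  of the order \<open>b\<^bsup>-k\<^esup>\<close> with \<open>k \<ge> n\<close>, it is the level \<open>m\<close> that is large. Thus ambiguities happen only at scales
  below the length of the initial interval.
\<close>

lemma ambiguity_level_large:
  fixes M k n :: nat
  defines "\<delta> \<equiv> 1 / (16 * real M * (real M + 1) ^ k)"
  assumes M: "1 \<le> M" and nk: "n \<le> k"
    and q: "real M + 1 - 2 * \<delta> \<le> q" "q \<le> real M + 1 - \<delta>"
    and amb: "ambiguous_prefix M (prefix_value c n (real M + 1)) q m d"
  shows "1 / (32 * real M) \<le> \<delta> * q ^ Suc m"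
proof -
  define b where "b = real M + 1"
  have b: "2 \<le> b" "b = real (Suc M)" using M by (auto simp: b_def)
  define x where "x = prefix_value c n b"
  define s where "s = max (Suc m) n"
  define V where "V = prefix_value d (Suc m)"
  have \<delta>b: "16 * real M * \<delta> * b ^ k = 1" using M by (simp add: \<delta>_def b_def)
  have bk: "1 \<le> b ^ k" using b by simp
  have \<delta>0: "0 < \<delta>" using M by (simp add: \<delta>_def)
  have "\<delta> * 16 \<le> \<delta> * (16 * real M * b ^ k)"
    using mult_mono[of 1 "real M" 1 "b ^ k"] M bk \<delta>0 by (intro mult_left_mono) auto
  then have \<delta>16: "\<delta> \<le> 1/16" using \<delta>b by (simp add: mult_ac)
  have q': "3/2 \<le> q" "q < b" "b - q \<le> 2 * \<delta>" using q \<delta>16 b \<delta>0 by (auto simp: b_def)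
  have amb': "\<And>j. j < Suc m \<Longrightarrow> d j \<le> M" "1 \<le> d m" "V q \<le> x" "x - V q \<le> (real M / (q - 1) - 1) / q ^ Suc m"
    using amb by (auto simp: ambiguous_prefix_def V_def x_def b_def)
  have frac: "(b - q) / (q - 1) \<le> 4 * \<delta>"
  proof -
    have "(b - q) / (q - 1) \<le> (2 * \<delta>) / (1/2)" using q' \<delta>0 by (intro frac_le) auto
    then show ?thesis by simp
  qed
  have "real M / (q - 1) - 1 = (b - q) / (q - 1)" using q' by (simp add: b_def field_simps)
  moreover have "(b - q) / (q - 1) / q ^ Suc m \<le> (b - q) / (q - 1) / 1"
    using q' by (intro divide_left_mono one_le_power) auto
  ultimately have y1: "x - V q \<le> 4 * \<delta>" using amb'(4) frac by simp
  have "V q - V b \<le> real M * (b - q) / ((q - 1) * (b - 1))"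
    unfolding V_def by (rule prefix_value_diff_le) (use q' amb' in auto)
  also have "\<dots> = (b - q) / (q - 1)" using M by (simp add: b_def)
  finally have y2: "V q - V b \<le> 4 * \<delta>" using frac by simp
  have Vpos: "0 < V q"
  proof -
    have "0 < real (d m) / q ^ Suc m" using amb'(2) q' by auto
    moreover have "0 \<le> prefix_value d m q"
      using prefix_value_mono[of q 0 m d] q' by (simp add: prefix_value_def[of _ 0])
    ultimately show ?thesis by (simp add: V_def prefix_value_Suc)
  qed
  have "V q * (b - q) / b \<le> V q - V b"
    unfolding V_def by (rule prefix_value_diff_ge) (use q' in auto)
  moreover have "0 < V q * (b - q) / b" using Vpos q' b by simp
  ultimately have y0: "0 < x - V b" using amb'(3) by linarith
  have "(x - V b) * b ^ s \<in> \<int>"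
    unfolding x_def V_def left_diff_distrib b(2)
    by (intro Ints_diff prefix_value_integral) (auto simp: s_def)
  moreover have "0 < (x - V b) * b ^ s" using y0 b by simp
  ultimately have "1 \<le> (x - V b) * b ^ s"
    using Ints_nonzero_abs_ge1[of "(x - V b) * b ^ s"] by linarith
  also have "\<dots> \<le> 8 * \<delta> * b ^ s" using y1 y2 b by (intro mult_right_mono) auto
  finally have one: "1 \<le> 8 * \<delta> * b ^ s" .
  \<comment> \<open>The factor 16 in \<open>\<delta>\<close> makes \<open>8 \<delta> b\<^bsup>k\<^esup> \<le> 1/2\<close>, so \<open>b\<^bsup>k\<^esup>\<close> is too small for the integrality bound.\<close>
  have "k < s"
  proof (rule ccontr)
    assume "\<not> k < s"
    then have "8 * \<delta> * b ^ s \<le> 8 * \<delta> * b ^ k" using b \<delta>0 by (intro mult_left_mono power_increasing) auto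
    also have "\<dots> \<le> 8 * \<delta> * b ^ k * real M" using b \<delta>0 M by (simp add: mult_ge1_I)
    also have "\<dots> = 1/2" using \<delta>b by (simp add: mult_ac)
    finally show False using one by simp
  qed
  then have km: "k \<le> Suc m" using nk by (auto simp: s_def)
  \<comment> \<open>\<open>k (b - q)\<close> is at most \<open>1/8\<close>, so the powers \<open>q\<^bsup>k\<^esup>\<close> and \<open>b\<^bsup>k\<^esup>\<close> differ by a factor of at most 2.\<close>
  have "real k \<le> 2 ^ k" using of_nat_less_two_power[of k, where 'a=real] by simp
  also have "\<dots> \<le> b ^ k" using b by (intro power_mono) auto
  finally have "real k * (b - q) \<le> b ^ k * (2 * \<delta>)" using q' b by (intro mult_mono) auto
  also have "\<dots> \<le> real M * (b ^ k * (2 * \<delta>))" using M b \<delta>0 by simp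
  also have "\<dots> = 1/8" using \<delta>b by (simp add: mult_ac)
  finally have "b ^ k \<le> 2 * q ^ k" using q' b by (intro power_ge_half_of_close) auto
  also have "\<dots> \<le> 2 * q ^ Suc m" using km q' by (intro mult_left_mono power_increasing) auto
  finally have "\<delta> * b ^ k \<le> 2 * (\<delta> * q ^ Suc m)" using \<delta>0 by (simp add: mult_left_mono)
  moreover have "\<delta> * b ^ k = 1 / (16 * real M)" using \<delta>b M by (simp add: field_simps)
  ultimately show ?thesis by simp
qed

section \<open>The lower bound\<close>

text \<open>
  Take \<open>R = 2\<^bsup>j\<^esup>\<close> and \<open>K = 2 (j + 1)\<close>; both \<open>R powr t\<close> and \<open>K\<close> are \<open>o(R)\<close>.
\<close>

lemma subdivision_exists:
  fixes t :: real and c :: nat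
  assumes "0 < t" "t < 1"
  obtains R K :: nat where "1 \<le> R" "2 * real R powr t + 2 * real (c * K) \<le> real R" "2 * real R \<le> (3/2) ^ K"
proof -
  have "(\<lambda>j. (2 * 2 powr (t * real j) + 4 * real c * (real j + 1)) / 2 powr real j) \<longlonglongrightarrow> 0"
    using assms by real_asymp
  then have "eventually (\<lambda>j. (2 * 2 powr (t * real j) + 4 * real c * (real j + 1)) / 2 powr real j < 1) sequentially"
    by (rule order_tendstoD) simp
  then obtain j where j: "2 * 2 powr (t * real j) + 4 * real c * (real j + 1) < 2 powr real j"
    by (auto simp: eventually_sequentially)
  have p: "2 powr real j = 2 ^ j" by (simp add: powr_realpow)
  have "(2::real) ^ Suc j \<le> (9/4) ^ Suc j" by (intro power_mono) auto
  also have "(9/4 :: real) ^ Suc j = ((3/2) ^ 2) ^ Suc j" by (simp add: power2_eq_square)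
  also have "\<dots> = (3/2) ^ (2 * Suc j)" by (rule power_mult[symmetric])
  finally have "2 * real (2 ^ j) \<le> (3/2) ^ (2 * Suc j)" by simp
  moreover have "real (2 ^ j) powr t = 2 powr (t * real j)" using p[symmetric] by (simp add: powr_powr mult.commute)
  ultimately show ?thesis using that[of "2 ^ j" "2 * Suc j"] j p by (simp add: algebra_simps)
qed

text \<open>
  The passage from a set of measure zero to the weights of the Cantor construction. Adding a geometric
  series makes all weights positive. The exponent may be raised because the cover has mesh at most 1; this
  disposes of \<open>s = 0\<close>, where the weight of a covering set does not see its diameter.
\<close>

lemma cover_of_null_set:
  fixes E :: "real set" and \<epsilon> :: real
  assumes H: "hausdorff_measure s E = 0" and s: "0 \<le> s" "s \<le> t" "0 < t" and \<epsilon>: "0 < \<epsilon>"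
  obtains U :: "nat \<Rightarrow> real set" and w where "E \<subseteq> (\<Union>i. U i)" "summable w" "\<And>i. 0 < w i" "suminf w < \<epsilon>"
    "\<And>i u v. u \<in> U i \<Longrightarrow> v \<in> U i \<Longrightarrow> \<bar>u - v\<bar> powr t \<le> w i"
proof -
  have "hausdorff_premeasure s 1 E \<le> hausdorff_measure s E"
    unfolding hausdorff_measure_def by (rule SUP_upper) simp
  then have "hausdorff_premeasure s 1 E < ennreal (\<epsilon> / 2)" using H \<epsilon> by simp
  then obtain U where U: "U \<in> small_covers 1 E" "(\<Sum>i. diam_weight s (U i)) < ennreal (\<epsilon> / 2)"
    unfolding hausdorff_premeasure_def INF_less_iff by blast
  have Ub: "bounded (U i)" "diameter (U i) \<le> 1" and cov: "E \<subseteq> (\<Union>i. U i)" for i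
    using U(1) by (auto simp: small_covers_def)
  define v where "v i = (if U i = {} then 0 else if s = 0 then 1 else diameter (U i) powr s)" for i
  have dv: "diam_weight s (U i) = ennreal (v i)" and v0: "0 \<le> v i" for i
    by (auto simp: diam_weight_def v_def)
  have "(\<Sum>i. ennreal (v i)) < ennreal (\<epsilon> / 2)" using U(2) by (simp add: dv)
  then have fin: "(\<Sum>i. ennreal (v i)) \<noteq> top" by auto
  have sv: "summable v" by (rule summable_suminf_not_top[OF v0 fin])
  have "ennreal (suminf v) < ennreal (\<epsilon> / 2)"
    using U(2) suminf_ennreal2[OF v0 sv] by (simp add: dv)
  then have vs: "suminf v < \<epsilon> / 2" using \<epsilon> suminf_nonneg[OF sv v0] by (simp add: ennreal_less_iff)
  have g: "(\<lambda>i. \<epsilon> / 2 * (1 / 2) ^ Suc i) sums (\<epsilon> / 2 * 1)" by (intro sums_mult power_half_series)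
  define w where "w i = v i + \<epsilon> / 2 * (1 / 2) ^ Suc i" for i
  have "w sums (suminf v + \<epsilon> / 2 * 1)" unfolding w_def by (intro sums_add summable_sums sv g)
  then have w: "summable w" "suminf w < \<epsilon>" using vs by (auto simp: sums_iff)
  have v_less_w: "v i < w i" for i using \<epsilon> by (simp add: w_def)
  show thesis
  proof (rule that[OF cov w(1) _ w(2)])
    show "0 < w i" for i using v_less_w[of i] v0[of i] by simp
    show "\<bar>p - r\<bar> powr t \<le> w i" if "p \<in> U i" "r \<in> U i" for i p r
    proof -
      have d: "\<bar>p - r\<bar> \<le> diameter (U i)"
        using diameter_bounded_bound[OF Ub(1) that] by (simp add: dist_real_def)
      have "\<bar>p - r\<bar> powr t \<le> v i"
      proof (cases "s = 0")
        case True
        have "\<bar>p - r\<bar> powr t \<le> 1 powr t" using d Ub(2)[of i] s by (intro powr_mono2) auto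
        then show ?thesis using True that by (auto simp: v_def)
      next
        case False
        have "\<bar>p - r\<bar> powr t \<le> \<bar>p - r\<bar> powr s" using d Ub(2)[of i] s by (intro powr_mono') auto
        also have "\<dots> \<le> diameter (U i) powr s" using d s by (intro powr_mono2) auto
        finally show ?thesis using False that by (auto simp: v_def)
      qed
      then show ?thesis using v_less_w[of i] by simp
    qed
  qed
qed

text \<open>
  The Cantor construction is run on \<open>[M + 1 - 2 L, M + 1 - L]\<close>. A base \<open>q\<close> that is first ambiguous for \<open>x\<close> at level \<open>m\<close>
  is put into the bad set of that step \<open>n\<close> at which \<open>q\<^bsup>-(m+1)\<^esup>\<close> is comparable with the
  current length. Each pair of \<open>x\<close> and a relevant level \<open>m\<close> then contributes one thin set per interval,
  and there are at most \<open>card X * K\<close> such pairs.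
\<close>

lemma hausdorff_measure_Inter_univoque_nonzero:
  fixes M :: nat and X :: "real set"
  assumes M: "1 \<le> M" and X: "finite X" "X \<subseteq> finite_expansions M" and s: "0 \<le> s" "s < 1"
  shows "hausdorff_measure s (\<Inter>x\<in>X. univoque_bases M x) \<noteq> 0"
proof
  define E where "E = (\<Inter>x\<in>X. univoque_bases M x)"
  assume "hausdorff_measure s (\<Inter>x\<in>X. univoque_bases M x) = 0"
  then have H: "hausdorff_measure s E = 0" by (simp add: E_def)
  define t where "t = max s (1/2)"
  have t: "0 < t" "t < 1" "s \<le> t" using s by (auto simp: t_def)
  obtain R K :: nat where R: "1 \<le> R" "2 * real R powr t + 2 * real (card X * K) \<le> real R" "2 * real R \<le> (3/2) ^ K"
    using subdivision_exists[OF t(1,2)] by metis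
  define \<delta> where "\<delta> k = 1 / (16 * real M * (real M + 1) ^ k)" for k
  define c where "c = 64 * real M * (real M + 1) * real R ^ 2"
  have \<delta>0: "0 < \<delta> k" for k using M by (simp add: \<delta>_def)
  have \<delta>lim: "(\<lambda>k. c * (4 * \<delta> k)) \<longlonglongrightarrow> 0"
  proof -
    have "(\<lambda>k. c * (4 * (1 / (16 * real M) * (1 / (real M + 1)) ^ k))) \<longlonglongrightarrow> c * (4 * (1 / (16 * real M) * 0))"
      using M by (intro tendsto_mult tendsto_const LIMSEQ_realpow_zero) auto
    then show ?thesis by (simp add: \<delta>_def power_one_over)
  qed
  \<comment> \<open>The number \<open>R\<close> of children is fixed first; then \<open>k\<close> is chosen so large that the overlap on the initial interval is small compared with \<open>R\<^bsup>-2\<^esup>\<close> and that all words of \<open>X\<close> have length at most \<open>k\<close>.\<close>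
  have "\<forall>x\<in>X. eventually (\<lambda>k. (0 < x \<longrightarrow> c * (4 * \<delta> k) < x) \<and> (\<exists>e n. n \<le> k \<and> x = prefix_value e n (real M + 1))) sequentially"
  proof
    fix x assume "x \<in> X"
    then obtain e n where en: "x = prefix_value e n (real M + 1)"
      using X finite_expansions_prefix_value by blast
    have "eventually (\<lambda>k. 0 < x \<longrightarrow> c * (4 * \<delta> k) < x) sequentially"
    proof (cases "0 < x")
      case True
      from order_tendstoD(2)[OF \<delta>lim this] show ?thesis by eventually_elim simp
    qed simp
    moreover have "eventually (\<lambda>k. \<exists>e n. n \<le> k \<and> x = prefix_value e n (real M + 1)) sequentially"
      using eventually_ge_at_top[of n] by eventually_elim (use en in blast)
    ultimately show "eventually (\<lambda>k. (0 < x \<longrightarrow> c * (4 * \<delta> k) < x) \<and> (\<exists>e n. n \<le> k \<and> x = prefix_value e n (real M + 1))) sequentially"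
      by (rule eventually_conj)
  qed
  then have "eventually (\<lambda>k. \<forall>x\<in>X. (0 < x \<longrightarrow> c * (4 * \<delta> k) < x) \<and> (\<exists>e n. n \<le> k \<and> x = prefix_value e n (real M + 1))) sequentially"
    by (rule eventually_ball_finite[OF X(1)])
  then obtain k where "\<forall>x\<in>X. (0 < x \<longrightarrow> c * (4 * \<delta> k) < x) \<and> (\<exists>e n. n \<le> k \<and> x = prefix_value e n (real M + 1))"
    unfolding eventually_sequentially by blast
  then have k: "\<And>x. x \<in> X \<Longrightarrow> 0 < x \<Longrightarrow> c * (4 * \<delta> k) < x"
    "\<And>x. x \<in> X \<Longrightarrow> \<exists>e n. n \<le> k \<and> x = prefix_value e n (real M + 1)"
    by blast+
  define L where "L = \<delta> k"
  define a0 where "a0 = real M + 1 - 2 * L"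
  define \<theta> where "\<theta> = 1 / (32 * real M)"
  have \<theta>: "0 < \<theta>" "\<theta> \<le> 1/4" using M by (auto simp: \<theta>_def field_simps)
  have L0: "0 < L" using \<delta>0 by (simp add: L_def)
  have "1 * 1 \<le> real M * (real M + 1) ^ k" using M by (intro mult_mono) auto
  then have L16: "L \<le> 1/16" by (simp add: L_def \<delta>_def field_simps)
  have J: "3/2 \<le> q" "q < real M + 1" "0 \<le> real M / (q - 1) - 1" "real M / (q - 1) - 1 \<le> 4 * L" if "q \<in> {a0..a0 + L}" for q
  proof -
    have q: "real M + 1 - 2 * L \<le> q" "q \<le> real M + 1 - L" using that by (auto simp: a0_def)
    show "3/2 \<le> q" "q < real M + 1" using q L16 L0 M by auto
    then have e: "real M / (q - 1) - 1 = (real M + 1 - q) / (q - 1)" by (simp add: field_simps)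
    show "0 \<le> real M / (q - 1) - 1" unfolding e using \<open>3/2 \<le> q\<close> \<open>q < real M + 1\<close> by simp
    have "(real M + 1 - q) / (q - 1) \<le> 2 * L / (1/2)"
      using q \<open>3/2 \<le> q\<close> L0 by (intro frac_le) auto
    then show "real M / (q - 1) - 1 \<le> 4 * L" unfolding e by simp
  qed
  define W where "W n q m \<longleftrightarrow> \<theta> / real R \<le> L / real R ^ n * q ^ Suc m \<and> L / real R ^ n * q ^ Suc m < \<theta>" for n q m
  define B where "B n = {q. \<exists>x\<in>X. \<exists>m. first_ambiguity M x q m \<and> W n q m}" for n
  obtain U :: "nat \<Rightarrow> real set" and w where U: "E \<subseteq> (\<Union>i. U i)" "summable w" "\<And>i. 0 < w i" "suminf w < (L / real R) powr t"
    "\<And>i u v. u \<in> U i \<Longrightarrow> v \<in> U i \<Longrightarrow> \<bar>u - v\<bar> powr t \<le> w i"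
    using cover_of_null_set[OF H s(1) t(3,1), of "(L / real R) powr t"] L0 R(1) by auto
  have "\<exists>q\<in>{a0..a0 + L}. \<forall>n. q \<notin> B n \<and> q \<notin> U n"
  proof (rule cantor_point_avoiding_cover[OF L0 t(1) _ R(2) _ U(2,3,4,5)])
    show "0 < R" using R by simp
    fix n a
    define l where "l = L / real R ^ n"
    have l0: "0 < l" using L0 R(1) by (simp add: l_def)
    assume "{a..a + L / real R ^ n} \<subseteq> {a0..a0 + L}"
    then have sub: "{a..a + l} \<subseteq> {a0..a0 + L}" by (simp add: l_def)
    define A where "A = {m. \<exists>q\<in>{a..a + l}. \<theta> / real R \<le> l * q ^ Suc m \<and> l * q ^ Suc m < \<theta>}"
    have "a \<in> {a..a + l}" using l0 by simp
    then have "3/2 \<le> a" using sub J(1) by blast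
    then have A: "finite A" "card A \<le> K" using card_window_le[OF _ l0 \<theta> R(1,3), of a] by (auto simp: A_def)
    define S where "S = (\<lambda>(x, m). {q \<in> {a..a + l}. first_ambiguity M x q m \<and> W n q m})"
    define F where "F = S ` (X \<times> A)"
    have "card F \<le> card (X \<times> A)" unfolding F_def using X A by (intro card_image_le) auto
    also have "\<dots> \<le> card X * K" using A(2) by (simp add: card_cartesian_product)
    finally have cF: "card F \<le> card X * K" .
    have thin: "\<bar>u - v\<bar> < L / real R ^ Suc n" if xm: "x \<in> X" "m \<in> A" "u \<in> S (x, m)" "v \<in> S (x, m)" for x m u v
    proof -
      have u: "u \<in> {a..a + l}" "first_ambiguity M x u m" "W n u m"
        and v: "v \<in> {a..a + l}" "first_ambiguity M x v m" "W n v m" using xm by (auto simp: S_def)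
      note Ju = J[OF subsetD[OF sub u(1)]] and Jv = J[OF subsetD[OF sub v(1)]]
      have x: "0 < x" using u(2) Ju(1) ambiguous_prefix_imp_pos[of u M x m] by (auto simp: first_ambiguity_def)
      have "\<bar>u - v\<bar> < l / real R"
      proof (rule first_ambiguities_thin[OF M R(1) l0])
        show "\<bar>u - v\<bar> \<le> l" using u(1) v(1) by auto
        show "64 * real M * (real M + 1) * real R ^ 2 * (4 * L) < x" using k(1)[OF xm(1) x] by (simp add: c_def L_def)
      qed (use Ju Jv u v L0 L16 in \<open>auto simp: W_def \<theta>_def l_def\<close>)
      then show ?thesis by (simp add: l_def mult.commute)
    qed
    have "B n \<inter> {a..a + l} \<subseteq> \<Union>F"
    proof
      fix q assume q: "q \<in> B n \<inter> {a..a + l}"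
      then obtain x m where xm: "x \<in> X" "first_ambiguity M x q m" "W n q m" by (auto simp: B_def)
      then have "m \<in> A" using q unfolding A_def W_def l_def by blast
      moreover have "q \<in> S (x, m)" using q xm by (simp add: S_def)
      ultimately show "q \<in> \<Union>F" using xm(1) unfolding F_def by blast
    qed
    then show "\<exists>F. finite F \<and> card F \<le> card X * K \<and> (\<forall>S\<in>F. \<forall>u\<in>S. \<forall>v\<in>S. \<bar>u - v\<bar> < L / real R ^ Suc n)
            \<and> B n \<inter> {a..a + L / real R ^ n} \<subseteq> \<Union>F"
      using cF thin X(1) A(1) unfolding l_def[symmetric] by (intro exI[of _ F]) (auto simp: F_def)
  qed
  then obtain q where q: "q \<in> {a0..a0 + L}" "\<And>n. q \<notin> B n" "\<And>n. q \<notin> U n" by blast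
  note Jq = J[OF q(1)]
  have "q \<in> univoque_bases M x" if x: "x \<in> X" for x
  proof (rule univoque_if_never_ambiguous)
    show "1 < q" "q \<le> real M + 1" using Jq by auto
    show "0 \<le> x" "x \<le> 1" using finite_expansions_bounds[OF _ M] X(2) x by auto
    fix m
    show "\<not> first_ambiguity M x q m"
    proof
      assume f: "first_ambiguity M x q m"
      \<comment> \<open>The ambiguity is finer than the initial interval, so the first step with \<open>L R\<^bsup>-n\<^esup> q\<^bsup>m+1\<^esup> < \<theta>\<close> is not step 0, and the previous step gives the lower bound \<open>\<theta>/R\<close>.\<close>
      have early: "\<theta> \<le> L * q ^ Suc m"
      proof -
        obtain e n where n: "n \<le> k" "x = prefix_value e n (real M + 1)" using k(2)[OF x] by blast
        obtain d where "ambiguous_prefix M x q m d" using f by (auto simp: first_ambiguity_def)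
        then show ?thesis
          using ambiguity_level_large[OF M n(1), of q e m d] q(1) n(2)
          unfolding \<theta>_def L_def \<delta>_def a0_def by auto
      qed
      have "(\<lambda>n. L * q ^ Suc m * (1 / real R) ^ n) \<longlonglongrightarrow> L * q ^ Suc m * 0"
      proof (intro tendsto_mult tendsto_const LIMSEQ_realpow_zero)
        have "2 * 1 \<le> 2 * real R powr t" using R(1) t by (simp add: ge_one_powr_ge_zero)
        then have "2 \<le> real R" using R(2) of_nat_0_le_iff[of "card X * K", where 'a=real] by linarith
        then show "1 / real R < 1" by simp
      qed simp
      then have "(\<lambda>n. L / real R ^ n * q ^ Suc m) \<longlonglongrightarrow> 0" by (simp add: power_one_over mult_ac)
      then have "eventually (\<lambda>n. L / real R ^ n * q ^ Suc m < \<theta>) sequentially"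
        using \<theta>(1) by (rule order_tendstoD)
      then have "\<exists>n. L / real R ^ n * q ^ Suc m < \<theta>" by (auto simp: eventually_sequentially)
      then obtain n where n: "L / real R ^ n * q ^ Suc m < \<theta>" "\<And>i. i < n \<Longrightarrow> \<theta> \<le> L / real R ^ i * q ^ Suc m"
        using exists_least_iff[of "\<lambda>n. L / real R ^ n * q ^ Suc m < \<theta>"] by (auto simp: not_less)
      have "n \<noteq> 0" using n(1) early by (cases n) auto
      then obtain i where i: "n = Suc i" by (cases n) auto
      have "\<theta> / real R \<le> L / real R ^ i * q ^ Suc m / real R" using n(2)[of i] i by (intro divide_right_mono) auto
      then have "W n q m" using n(1) by (simp add: W_def i mult_ac)
      then show False using q(2)[of n] f x by (auto simp: B_def)
    qed
  qed
  then have "q \<in> E" using Jq by (auto simp: E_def)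
  then show False using U(1) q(3) by blast
qed


theorem theorem1p2:
  fixes M l :: nat and x :: "nat \<Rightarrow> real"
  assumes "M \<ge> 1" and "l \<ge> 1"
    and "\<And>i. i \<in> {1..l} \<Longrightarrow> x i \<in> finite_expansions M"
  shows "hausdorff_dim (\<Inter>i\<in>{1..l}. univoque_bases M (x i)) = 1"
proof (rule antisym)
  let ?E = "\<Inter>i\<in>{1..l}. univoque_bases M (x i)"
  have "?E \<subseteq> univoque_bases M (x 1)" using assms(2) by auto
  also have "\<dots> \<subseteq> {1..real M + 1}" by (auto simp: univoque_bases_def)
  finally have "bounded ?E" by (rule bounded_subset[OF bounded_closed_interval])
  then show "hausdorff_dim ?E \<le> 1" by (rule hausdorff_dim_real_le_1)
  have "1 \<le> s" if "0 \<le> s" "hausdorff_measure s ?E = 0" for s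
    using hausdorff_measure_Inter_univoque_nonzero[OF assms(1), of "x ` {1..l}" s] assms(3) that
    by (fastforce simp: not_le)
  then show "1 \<le> hausdorff_dim ?E"
    unfolding hausdorff_dim_def by (intro Inf_greatest) auto
qed

end
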